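(* Let $p$ be a prime, and let $K=\{k_1,k_2,\ldots,k_r\}$ and $L=\{l_1,l_2,\ldots,l_s\}$ be two disjoint subsets of $\{0,1,\ldots,p-1\}$ (with $r=|K|\ge 1$, $s=|L|$). Let $\mathcal{A}=\{A_1,\ldots,A_m\}$ be a family of distinct subsets of $[n]=\{1,\ldots,n\}$ such that $|A_i| \pmod p\in K$ for every $i$ and $|A_i\cap A_j|\pmod p\in L$ for every $i\neq j$. If $n\ge s+\max_{1\le i\le r}k_i$, then \[ |\mathcal{A}|\le \binom{n-1}{s}+\binom{n-1}{s-1}+\cdots+\binom{n-1}{s-2r+1}. \]
   Context: Binomial coefficients $\binom{a}{b}$ with $b<0$ are interpreted as $0$. *)

theory Defs
  imports Main "HOL-Computational_Algebra.Primes"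
begin

definition binom_int :: "nat \<Rightarrow> int \<Rightarrow> nat" where
  "binom_int a b = (if b < 0 then 0 else a choose (nat b))"

end

theory Submission
  imports Defs "HOL-Library.FuncSet" "HOL-Computational_Algebra.Polynomial"
begin

text \<open>
  On subsets \<open>X\<close> of \<open>U = {1..n-1}\<close>, with \<open>r = |K|\<close> and \<open>s = |L|\<close>, consider modulo \<open>p\<close> the functions
  \<open>f\<^sub>A X = \<Prod>l\<in>L. (|A \<inter> (X \<union> {n})| - l)\<close> for \<open>A \<in> \<A>\<close>, and \<open>x\<^sub>H g\<close> for \<open>|H| \<le> s - 2r\<close>, where
  \<open>x\<^sub>H\<close> is the monomial of \<open>H\<close> and \<open>g X = \<Prod>k\<in>K. (|X| - k) (|X| + 1 - k)\<close>. All of them are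
  multilinear of degree at most \<open>s\<close>, so the bound follows once they are shown to be linearly
  independent. In a linear relation, evaluation at \<open>A - {n}\<close>, first for the \<open>A\<close> containing \<open>n\<close>
  and then for the others, kills the coefficients of the \<open>f\<^sub>A\<close>, because \<open>g\<close> vanishes at these points.

  What remains is a multilinear \<open>h\<close> of degree at most \<open>d = s - 2r\<close> that vanishes on every layer on
  which \<open>g\<close> does not. If \<open>h\<close> is not symmetric, then \<open>h\<close> minus its transpose under some swap of
  \<open>i\<close> and \<open>k\<close> equals \<open>(x\<^sub>i - x\<^sub>k) h'\<close> with \<open>h' \<noteq> 0\<close> of degree at most \<open>d - 1\<close> on \<open>U - {i, k}\<close>, vanishing on
  the layers shifted by one. Iterating, one reaches after \<open>j\<close> steps a symmetric function, which is a
  polynomial of degree at most \<open>d - j\<close> in \<open>|X|\<close>. The hypothesis \<open>n \<ge> s + max K\<close> leaves enough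
  residues of layers in \<open>{j..n-1-j}\<close> for this polynomial to be zero.
\<close>

section \<open>Linear systems modulo \<open>p\<close>\<close>

text \<open>Pigeonhole: there are \<open>p ^ card V\<close> coefficient vectors with entries reduced
  modulo \<open>p\<close>, but only \<open>p ^ card E\<close> possible vectors of values. Two
  vectors with the same values differ by a nontrivial solution.\<close>

lemma homogeneous_system_mod:
  fixes a :: "'v \<Rightarrow> 'e \<Rightarrow> int" and p :: nat
  assumes "finite E" "finite V" "card E < card V" "p > 1"
  shows "\<exists>c. (\<exists>v\<in>V. \<not> int p dvd c v) \<and> (\<forall>e\<in>E. int p dvd (\<Sum>v\<in>V. c v * a v e))"
proof -
  let ?R = "{0..<int p}"
  define \<Phi> where "\<Phi> c = restrict (\<lambda>e. (\<Sum>v\<in>V. c v * a v e) mod int p) E" for c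
  have maps: "\<Phi> \<in> (V \<rightarrow>\<^sub>E ?R) \<rightarrow> (E \<rightarrow>\<^sub>E ?R)"
    using assms by (auto simp: \<Phi>_def)
  have "card (E \<rightarrow>\<^sub>E ?R) < card (V \<rightarrow>\<^sub>E ?R)"
    using assms by (simp add: card_PiE)
  moreover have "finite (E \<rightarrow>\<^sub>E ?R)"
    using assms by (intro finite_PiE) auto
  ultimately have "\<not> inj_on \<Phi> (V \<rightarrow>\<^sub>E ?R)"
    using maps by (metis card_inj_on_le funcset_image not_less)
  then obtain x y where xy: "x \<in> V \<rightarrow>\<^sub>E ?R" "y \<in> V \<rightarrow>\<^sub>E ?R" "x \<noteq> y" "\<Phi> x = \<Phi> y"
    by (auto simp: inj_on_def)
  obtain v where v: "v \<in> V" "x v \<noteq> y v"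
    using xy by (meson PiE_ext)
  have "x v mod int p = x v" "y v mod int p = y v"
    using xy(1,2) v(1) by (auto simp: PiE_def Pi_def)
  with v(2) have "\<not> int p dvd x v - y v"
    by (metis mod_eq_dvd_iff)
  moreover have "int p dvd (\<Sum>v\<in>V. (x v - y v) * a v e)" if "e \<in> E" for e
  proof -
    have "(\<Sum>v\<in>V. x v * a v e) mod int p = (\<Sum>v\<in>V. y v * a v e) mod int p"
      using fun_cong[OF xy(4), of e] that by (simp add: \<Phi>_def)
    then show ?thesis
      by (simp add: mod_eq_dvd_iff left_diff_distrib sum_subtractf)
  qed
  ultimately show ?thesis
    using v(1) by (intro exI[of _ "\<lambda>v. x v - y v"]) auto
qed

section \<open>Multilinear functions of bounded degree\<close>

text \<open>The set \<open>X\<close> stands for its characteristic vector, at which the monomial of \<open>J\<close> takes the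
  value 1 if \<open>J \<subseteq> X\<close> and 0 otherwise; \<open>b J\<close> is the coefficient of that monomial.\<close>

definition multilinear_le :: "'a set \<Rightarrow> nat \<Rightarrow> ('a set \<Rightarrow> int) \<Rightarrow> bool" where
  "multilinear_le U d F \<longleftrightarrow> (\<exists>b. \<forall>X\<subseteq>U. F X = (\<Sum>J | J \<subseteq> X \<and> card J \<le> d. b J))"

lemma finite_subsets_card_le [simp]: "finite X \<Longrightarrow> finite {J. J \<subseteq> X \<and> card J \<le> d}"
  by (rule finite_subset[of _ "Pow X"]) auto

lemma multilinear_le_monomial:
  assumes "finite U" "card H \<le> d"
  shows "multilinear_le U d (\<lambda>X. of_bool (H \<subseteq> X))"
  unfolding multilinear_le_def
proof (intro exI allI impI)
  fix X assume "X \<subseteq> U"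
  then have "finite X" using assms finite_subset by blast
  then show "of_bool (H \<subseteq> X) = (\<Sum>J | J \<subseteq> X \<and> card J \<le> d. of_bool (J = H))"
    using assms(2) by (simp add: of_bool_def sum.delta)
qed

lemma multilinear_le_sum:
  assumes "\<And>v. v \<in> V \<Longrightarrow> multilinear_le U d (F v)"
  shows "multilinear_le U d (\<lambda>X. \<Sum>v\<in>V. c v * F v X)"
proof -
  obtain b where b: "\<And>v X. v \<in> V \<Longrightarrow> X \<subseteq> U \<Longrightarrow> F v X = (\<Sum>J | J \<subseteq> X \<and> card J \<le> d. b v J)"
    using assms unfolding multilinear_le_def by metis
  show ?thesis
    unfolding multilinear_le_def
  proof (intro exI allI impI)
    fix X assume "X \<subseteq> U"
    then have "(\<Sum>v\<in>V. c v * F v X) = (\<Sum>v\<in>V. \<Sum>J | J \<subseteq> X \<and> card J \<le> d. c v * b v J)"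
      by (simp add: b sum_distrib_left)
    also have "\<dots> = (\<Sum>J | J \<subseteq> X \<and> card J \<le> d. \<Sum>v\<in>V. c v * b v J)"
      by (rule sum.swap)
    finally show "(\<Sum>v\<in>V. c v * F v X) = (\<Sum>J | J \<subseteq> X \<and> card J \<le> d. \<Sum>v\<in>V. c v * b v J)" .
  qed
qed

lemma multilinear_le_cong:
  assumes "multilinear_le U d F" "\<And>X. X \<subseteq> U \<Longrightarrow> F X = G X"
  shows "multilinear_le U d G"
  using assms unfolding multilinear_le_def by metis

lemma multilinear_le_add:
  assumes "multilinear_le U d F" "multilinear_le U d G"
  shows "multilinear_le U d (\<lambda>X. F X + G X)"
proof -
  have "multilinear_le U d (\<lambda>X. \<Sum>v\<in>UNIV. 1 * (if v then F else G) X)"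
    using assms by (intro multilinear_le_sum) auto
  then show ?thesis by (simp add: UNIV_bool add.commute)
qed

text \<open>An index set independent of \<open>X\<close> exhibits \<open>F\<close> as a linear
  combination of monomials, so that closure under sums applies.\<close>

lemma multilinear_le_expand:
  assumes "multilinear_le U d F" "finite U"
  obtains b where "\<And>X. X \<subseteq> U \<Longrightarrow> F X = (\<Sum>J | J \<subseteq> U \<and> card J \<le> d. b J * of_bool (J \<subseteq> X))"
proof -
  obtain b where b: "\<And>X. X \<subseteq> U \<Longrightarrow> F X = (\<Sum>J | J \<subseteq> X \<and> card J \<le> d. b J)"
    using assms unfolding multilinear_le_def by metis
  show thesis
  proof (rule that)
    fix X assume X: "X \<subseteq> U"
    show "F X = (\<Sum>J | J \<subseteq> U \<and> card J \<le> d. b J * of_bool (J \<subseteq> X))"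
      unfolding b[OF X] using X assms(2)
      by (intro sum.mono_neutral_cong_left) auto
  qed
qed

lemma multilinear_le_mono:
  assumes "multilinear_le U d F" "d \<le> e" "finite U"
  shows "multilinear_le U e F"
proof -
  from multilinear_le_expand[OF assms(1,3)] obtain b
    where b: "\<And>X. X \<subseteq> U \<Longrightarrow> F X = (\<Sum>J | J \<subseteq> U \<and> card J \<le> d. b J * of_bool (J \<subseteq> X))" by blast
  have "multilinear_le U e (\<lambda>X. \<Sum>J | J \<subseteq> U \<and> card J \<le> d. b J * of_bool (J \<subseteq> X))"
    using assms(2,3) by (intro multilinear_le_sum multilinear_le_monomial) auto
  then show ?thesis
    by (rule multilinear_le_cong) (simp add: b)
qed

text \<open>On 0/1 vectors a variable equals its square, so multiplying by it turns the monomial of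
  \<open>J\<close> into that of \<open>insert i J\<close>, and the product stays
  multilinear.\<close>

lemma multilinear_le_mult_var:
  assumes "multilinear_le U d F" "finite U"
  shows "multilinear_le U (Suc d) (\<lambda>X. F X * of_bool (i \<in> X))"
proof -
  from multilinear_le_expand[OF assms] obtain b
    where b: "\<And>X. X \<subseteq> U \<Longrightarrow> F X = (\<Sum>J | J \<subseteq> U \<and> card J \<le> d. b J * of_bool (J \<subseteq> X))" by blast
  have "multilinear_le U (Suc d)
      (\<lambda>X. \<Sum>J | J \<subseteq> U \<and> card J \<le> d. b J * of_bool (insert i J \<subseteq> X))"
    using assms(2) by (intro multilinear_le_sum multilinear_le_monomial)
      (auto intro: order.trans[OF card_insert_le_m1] simp: card_insert_if finite_subset)
  then show ?thesis
    by (rule multilinear_le_cong) (auto simp: b sum_distrib_right intro!: sum.cong)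
qed

lemma multilinear_le_mult_linear:
  assumes "multilinear_le U d F" "finite U"
  shows "multilinear_le U (Suc d) (\<lambda>X. F X * (\<alpha> + int (card (B \<inter> X))))"
proof -
  \<comment> \<open>The cardinality is the linear form summing the variables in
    \<open>B \<inter> U\<close>. The one-element index set makes the scalar multiple of
    \<open>F\<close> an instance of closure under sums.\<close>
  have "multilinear_le U (Suc d)
      (\<lambda>X. (\<Sum>i\<in>{()}. \<alpha> * F X) + (\<Sum>i\<in>B \<inter> U. 1 * (F X * of_bool (i \<in> X))))"
    using assms
    by (intro multilinear_le_add multilinear_le_sum multilinear_le_mult_var)
       (auto intro: multilinear_le_mono)
  then show ?thesis
  proof (rule multilinear_le_cong)
    fix X assume "X \<subseteq> U"
    then have eq: "B \<inter> U \<inter> X = B \<inter> X" by auto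
    have "(\<Sum>i\<in>B \<inter> U. of_bool (i \<in> X)) = int (card (B \<inter> X))"
      using assms(2) sum_of_bool_eq[of "B \<inter> U" "\<lambda>i. i \<in> X"] by (simp add: eq)
    then show "(\<Sum>i\<in>{()}. \<alpha> * F X) + (\<Sum>i\<in>B \<inter> U. 1 * (F X * of_bool (i \<in> X)))
        = F X * (\<alpha> + int (card (B \<inter> X)))"
      by (simp add: algebra_simps flip: sum_distrib_left)
  qed
qed

lemma multilinear_le_mult_prod_linear:
  assumes "multilinear_le U d F" "finite U" "finite M"
  shows "multilinear_le U (d + card M) (\<lambda>X. F X * (\<Prod>m\<in>M. \<alpha> m + int (card (B \<inter> X))))"
  using assms(3)
proof (induction M rule: finite_induct)
  case empty
  then show ?case using assms(1) by simp
next
  case (insert m M)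
  from multilinear_le_mult_linear[OF insert.IH assms(2), of "\<alpha> m" B] insert.hyps
  show ?case by (simp add: mult_ac)
qed

text \<open>A coefficient vector has one entry per set of size at most \<open>d\<close>, hence fewer
  entries than there are functions. A relation between the coefficients carries over to the
  values.\<close>

lemma multilinear_le_dependent_mod:
  fixes F :: "'v \<Rightarrow> 'a set \<Rightarrow> int" and p :: nat
  assumes "finite U" "finite V" "p > 1"
    and "\<And>v. v \<in> V \<Longrightarrow> multilinear_le U d (F v)"
    and "card {J. J \<subseteq> U \<and> card J \<le> d} < card V"
  obtains c where "\<exists>v\<in>V. \<not> int p dvd c v"
    and "\<And>X. X \<subseteq> U \<Longrightarrow> int p dvd (\<Sum>v\<in>V. c v * F v X)"
proof -
  obtain b where b: "\<And>v X. v \<in> V \<Longrightarrow> X \<subseteq> U \<Longrightarrow> F v X = (\<Sum>J | J \<subseteq> X \<and> card J \<le> d. b v J)"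
    using assms(4) unfolding multilinear_le_def by metis
  obtain c where c: "\<exists>v\<in>V. \<not> int p dvd c v"
    "\<And>J. J \<subseteq> U \<Longrightarrow> card J \<le> d \<Longrightarrow> int p dvd (\<Sum>v\<in>V. c v * b v J)"
    using homogeneous_system_mod[OF _ assms(2,5,3), of b] assms(1) by auto
  show thesis
  proof (rule that[OF c(1)])
    fix X assume X: "X \<subseteq> U"
    have "(\<Sum>v\<in>V. c v * F v X) = (\<Sum>v\<in>V. \<Sum>J | J \<subseteq> X \<and> card J \<le> d. c v * b v J)"
      using X by (simp add: b sum_distrib_left)
    also have "\<dots> = (\<Sum>J | J \<subseteq> X \<and> card J \<le> d. \<Sum>v\<in>V. c v * b v J)"
      by (rule sum.swap)
    also have "int p dvd \<dots>"
      using X by (intro dvd_sum c(2)) auto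
    finally show "int p dvd (\<Sum>v\<in>V. c v * F v X)" .
  qed
qed

section \<open>Polynomials with many roots modulo \<open>p\<close>\<close>

text \<open>Splitting off the linear factor of a root \<open>a\<close> leaves a quotient that
  vanishes modulo \<open>p\<close> on \<open>S - {a}\<close>, since \<open>x - a\<close> is
  invertible there.\<close>

lemma int_poly_dvd_everywhere:
  fixes q :: "int poly" and p :: nat
  assumes "prime p" "finite S" "inj_on (\<lambda>t. t mod int p) S" "degree q < card S"
    and "\<And>x. x \<in> S \<Longrightarrow> int p dvd poly q x"
  shows "int p dvd poly q y"
  using assms(2-5)
proof (induction "card S" arbitrary: S q y)
  case 0
  then show ?case by simp
next
  case (Suc N)
  then obtain a where a: "a \<in> S" by fastforce
  define q' where "q' = synthetic_div q a"
  have q: "poly q x = (x - a) * poly q' x + poly q a" for x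
    using arg_cong[OF synthetic_div_correct'[of a q], of "\<lambda>r. poly r x"]
    by (simp add: q'_def algebra_simps)
  show ?case
  proof (cases "degree q = 0")
    case True
    then obtain k where "q = [:k:]" by (rule degree_eq_zeroE)
    then show ?thesis using Suc.prems(4)[OF a] by simp
  next
    case False
    have "int p dvd poly q' y"
    proof (rule Suc.hyps(1))
      show "N = card (S - {a})" "finite (S - {a})"
        using Suc.hyps(2) Suc.prems(1) a by auto
      show "inj_on (\<lambda>t. t mod int p) (S - {a})"
        using Suc.prems(2) by (auto simp: inj_on_def)
      show "degree q' < card (S - {a})"
        using False Suc.prems(1,3) Suc.hyps(2) a by (simp add: q'_def degree_synthetic_div)
      fix x assume x: "x \<in> S - {a}"
      have "int p dvd (x - a) * poly q' x"
        using dvd_diff[OF Suc.prems(4)[of x] Suc.prems(4)[OF a]] x q[of x] by simp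
      moreover have "\<not> int p dvd x - a"
        using Suc.prems(2) x a by (auto simp: inj_on_def mod_eq_dvd_iff)
      ultimately show "int p dvd poly q' x"
        using assms(1) by (simp add: prime_dvd_mult_iff)
    qed
    then show ?thesis
      unfolding q[of y] using Suc.prems(4)[OF a] by simp
  qed
qed

text \<open>As functions of \<open>t\<close>, the binomials up to \<open>D\<close> form a basis of
  the polynomials of degree at most \<open>D\<close> modulo \<open>p\<close>, and such a polynomial
  with more than \<open>D\<close> roots is zero.\<close>

lemma binomial_combination_dvd:
  fixes c :: "nat \<Rightarrow> int" and p :: nat
  assumes "prime p" "D < p" "finite S" "inj_on (\<lambda>t. t mod p) S" "D < card S"
    and "\<And>t. t \<in> S \<Longrightarrow> int p dvd (\<Sum>i\<le>D. c i * int (t choose i))"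
    and "i \<le> D"
  shows "int p dvd c i"
proof -
  \<comment> \<open>\<open>q\<close> is \<open>fact D\<close> times the combination, which clears
    all denominators. As \<open>D < p\<close>, this factor is invertible modulo
    \<open>p\<close>.\<close>
  define q where "q = (\<Sum>i\<le>D. smult (c i * int (fact D div fact i)) (\<Prod>m<i. [:- int m, 1:]))"
  have q: "poly q (int t) = fact D * (\<Sum>i\<le>D. c i * int (t choose i))" for t
  proof -
    have "int (fact D div fact i) * (\<Prod>m<i. int t - int m) = fact D * int (t choose i)" if "i \<le> D" for i
    proof -
      have "(\<Prod>m<i. int t - int m) = fact i * int (t choose i)"
      proof (induction i)
        case (Suc i)
        have "int (Suc i) * int (t choose Suc i) = int (t choose i) * (int t - int i)"
        proof (cases "i \<le> t")
          case True
          have "Suc i * (t choose Suc i) = (t choose i) * (t - i)"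
            using binomial_absorb_comp[of t i] binomial_absorption[of i t]
            by (simp only: mult.commute[of "t choose i"])
          then have "int (Suc i * (t choose Suc i)) = int ((t choose i) * (t - i))" by simp
          then show ?thesis using True by (simp only: of_nat_mult of_nat_diff)
        qed (simp add: binomial_eq_0)
        then have "fact i * (int (Suc i) * int (t choose Suc i)) = fact i * int (t choose i) * (int t - int i)"
          by (simp only: mult.assoc)
        then show ?case using Suc by (simp add: algebra_simps)
      qed simp
      moreover have "fact D div fact i * fact i = (fact D :: nat)"
        using that by (simp add: fact_dvd)
      then have "int (fact D div fact i) * fact i = fact D"
        by (metis of_nat_fact of_nat_mult)
      ultimately show ?thesis by (simp add: mult.assoc[symmetric])
    qed
    then show ?thesis
      by (simp add: q_def poly_sum poly_prod sum_distrib_left mult_ac)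
  qed
  have "degree q \<le> D"
    unfolding q_def
  proof (intro degree_sum_le order.trans[OF degree_smult_le])
    fix i assume "i \<in> {..D}"
    moreover have "degree (\<Prod>m<i. [:- int m, 1:]) \<le> (\<Sum>m<i. 1)"
      by (intro order.trans[OF degree_prod_sum_le] sum_mono) auto
    ultimately show "degree (\<Prod>m<i. [:- int m, 1:]) \<le> D" by simp
  qed simp
  have "int p dvd poly q (int t)" for t
  proof (rule int_poly_dvd_everywhere[OF assms(1), of "int ` S"])
    show "finite (int ` S)" using assms(3) by simp
    show "inj_on (\<lambda>t. t mod int p) (int ` S)"
      using assms(4) by (auto simp: inj_on_def simp flip: zmod_int)
    show "degree q < card (int ` S)"
      using \<open>degree q \<le> D\<close> assms(5) by (simp add: card_image)
  qed (use assms(6) q in auto)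
  moreover have "\<not> int p dvd fact D"
    using assms(1,2) by (metis int_dvd_int_iff leD of_nat_fact prime_dvd_fact_iff)
  ultimately have all: "int p dvd (\<Sum>i\<le>D. c i * int (t choose i))" for t
    using assms(1) by (auto simp: q prime_dvd_mult_iff)
  \<comment> \<open>The system is triangular: at \<open>t = i\<close> the binomials above
    \<open>i\<close> vanish and the one at \<open>i\<close> is 1.\<close>
  show ?thesis
    using assms(7)
  proof (induction i rule: less_induct)
    case (less i)
    have "(\<Sum>k\<le>D. c k * int (i choose k)) = (\<Sum>k\<le>i. c k * int (i choose k))"
      using less.prems by (intro sum.mono_neutral_right) (auto simp: binomial_eq_0)
    also have "\<dots> = (\<Sum>k<i. c k * int (i choose k)) + c i"
      by (simp add: lessThan_Suc_atMost[symmetric])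
    finally have "int p dvd (\<Sum>k<i. c k * int (i choose k)) + c i" using all[of i] by simp
    moreover have "int p dvd (\<Sum>k<i. c k * int (i choose k))"
      using less by (intro dvd_sum) auto
    ultimately show ?case by (simp add: dvd_add_right_iff)
  qed
qed

section \<open>Functions vanishing on layers\<close>

lemma sum_subsets_insert:
  fixes b :: "'a set \<Rightarrow> int"
  assumes "finite X" "i \<notin> X"
  shows "(\<Sum>J | J \<subseteq> insert i X \<and> card J \<le> Suc d. b J) =
    (\<Sum>J | J \<subseteq> X \<and> card J \<le> Suc d. b J) + (\<Sum>J | J \<subseteq> X \<and> card J \<le> d. b (insert i J))"
proof -
  have fin: "J \<subseteq> X \<Longrightarrow> finite J" for J using assms finite_subset by blast
  have eq: "{J. J \<subseteq> insert i X \<and> card J \<le> Suc d} =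
    {J. J \<subseteq> X \<and> card J \<le> Suc d} \<union> insert i ` {J. J \<subseteq> X \<and> card J \<le> d}" (is "?L = ?R")
  proof (intro equalityI subsetI)
    fix J assume J: "J \<in> ?L"
    show "J \<in> ?R"
    proof (cases "i \<in> J")
      case True
      have "finite J" using J assms(1) by (auto intro: finite_subset)
      then have "J - {i} \<subseteq> X" "card (J - {i}) \<le> d" "J = insert i (J - {i})"
        using J True by auto
      then show ?thesis by blast
    qed (use J in auto)
  next
    fix J assume "J \<in> ?R"
    then show "J \<in> ?L"
      using assms(2) by (auto simp: card_insert_if fin)
  qed
  have "inj_on (insert i) {J. J \<subseteq> X \<and> card J \<le> d}"
    using assms(2) by (intro inj_onI) (metis (no_types, lifting) insert_ident mem_Collect_eq subsetD)
  then show ?thesis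
    unfolding eq using assms
    by (subst sum.union_disjoint) (auto simp: sum.reindex)
qed

text \<open>\<open>I\<close> is transformed into \<open>J\<close> by single exchanges, each of which
  lowers \<open>card (I - J)\<close>.\<close>

lemma exchange_invariant_cong:
  fixes b :: "'a set \<Rightarrow> int" and p :: nat
  assumes "finite U"
    and ex: "\<And>i k J. i \<in> U \<Longrightarrow> k \<in> U \<Longrightarrow> i \<noteq> k \<Longrightarrow> J \<subseteq> U - {i, k} \<Longrightarrow> card J < d \<Longrightarrow>
      int p dvd b (insert i J) - b (insert k J)"
    and "I \<subseteq> U" "J \<subseteq> U" "card I = card J" "card J \<le> d"
  shows "int p dvd b I - b J"
  using assms(3,5)
proof (induction "card (I - J)" arbitrary: I)
  case 0
  have "finite I" "finite J" using 0 assms finite_subset by blast+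
  then have "I \<subseteq> J" using 0 by auto
  then have "I = J" using \<open>finite J\<close> 0 by (simp add: card_subset_eq)
  then show ?case by simp
next
  case (Suc N)
  have fin: "finite I" "finite J" using Suc assms finite_subset by blast+
  obtain i where i: "i \<in> I" "i \<notin> J" using Suc.hyps(2) by (metis Diff_iff card.empty equals0I nat.distinct(1))
  then have "\<not> J \<subseteq> I"
    using fin Suc.prems by (metis card_subset_eq)
  then obtain k where k: "k \<in> J" "k \<notin> I" by auto
  let ?I = "insert k (I - {i})"
  have "card I > 0" using i fin card_gt_0_iff by blast
  then have card: "card ?I = card J" using fin i k Suc.prems by (simp add: card_insert_if)
  have "?I - J = (I - J) - {i}" using k by auto
  then have "N = card (?I - J)" using Suc.hyps(2) i fin by simp
  then have "int p dvd b ?I - b J"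
    using Suc.hyps(1)[of ?I] card Suc.prems k assms(4) by auto
  moreover have "int p dvd b (insert i (I - {i})) - b ?I"
    using i k Suc.prems assms(4,6) \<open>card I > 0\<close> fin by (intro ex) auto
  ultimately have "int p dvd (b (insert i (I - {i})) - b ?I) + (b ?I - b J)"
    using dvd_add by blast
  then show ?case using i by (simp add: insert_absorb)
qed

text \<open>Here \<open>j\<close> counts exchange steps. After \<open>j\<close> of them
  \<open>2 * j\<close> points are gone and sizes have dropped by \<open>j\<close>, so the remaining
  layers, in original sizes, are \<open>{j..card U - j}\<close>. A symmetric function there has
  degree at most \<open>min (d - j) (card U - 2 * j)\<close>; one more layer than that, with
  distinct residues, forces it to be zero. Asking this for every \<open>j\<close> lets the induction
  on \<open>d\<close> pass it on with \<open>j\<close> shifted by one.\<close>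

lemma coeffs_dvd_if_vanishing_on_layers:
  fixes b :: "'a set \<Rightarrow> int" and p :: nat
  assumes "prime p" "finite U" "d < p"
    and "\<And>j. j \<le> d \<Longrightarrow> 2 * j \<le> card U \<Longrightarrow>
      \<exists>S. S \<subseteq> T \<and> S \<subseteq> {j..card U - j} \<and> inj_on (\<lambda>t. t mod p) S \<and> min (d - j) (card U - 2 * j) < card S"
    and "\<And>X. X \<subseteq> U \<Longrightarrow> card X \<in> T \<Longrightarrow> int p dvd (\<Sum>J | J \<subseteq> X \<and> card J \<le> d. b J)"
    and "J \<subseteq> U" "card J \<le> d"
  shows "int p dvd b J"
  using assms(2-)
proof (induction d arbitrary: U T b J)
  case (0 U T b J)
  obtain S where S: "S \<subseteq> T" "S \<subseteq> {0..card U}" "card S > 0"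
    using 0(3)[of 0] by auto
  then obtain t where t: "t \<in> T" "t \<le> card U" by (metis atLeastAtMost_iff card_gt_0_iff equals0I subsetD)
  obtain X where X: "X \<subseteq> U" "card X = t" using t(2) by (meson obtain_subset_with_card_n)
  have "{J. J \<subseteq> X \<and> card J \<le> 0} = {{}}"
    using X(1) 0(1) by (auto dest: finite_subset)
  then have "int p dvd b {}" using 0(4)[of X] X t by simp
  moreover have "J = {}" using 0 by (auto dest: finite_subset)
  ultimately show ?case by simp
next
  case (Suc d U T b J)
  note finU = Suc.prems(1)
  \<comment> \<open>The coefficients of \<open>h'\<close> in \<open>h - h\<^bsup>(i k)\<^esup> = (x\<^sub>i - x\<^sub>k) h'\<close>.\<close>
  have ex: "int p dvd b (insert i I) - b (insert k I)"
    if ik: "i \<in> U" "k \<in> U" "i \<noteq> k" and I: "I \<subseteq> U - {i, k}" "card I < Suc d" for i k I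
  proof (rule Suc.IH[where U = "U - {i, k}" and T = "{t. Suc t \<in> T}"
        and b = "\<lambda>I. b (insert i I) - b (insert k I)"])
    show "finite (U - {i, k})" "d < p" "I \<subseteq> U - {i, k}" "card I \<le> d"
      using Suc.prems I by auto
    have "card {i, k} \<le> card U" using finU ik by (intro card_mono) auto
    then have cU: "card (U - {i, k}) = card U - 2" "card U \<ge> 2"
      using ik finU by (auto simp: card_Diff_subset)
    show "\<exists>S. S \<subseteq> {t. Suc t \<in> T} \<and> S \<subseteq> {j..card (U - {i, k}) - j} \<and> inj_on (\<lambda>t. t mod p) S \<and>
        min (d - j) (card (U - {i, k}) - 2 * j) < card S"
      if j: "j \<le> d" "2 * j \<le> card (U - {i, k})" for j
    proof -
      obtain S where S: "S \<subseteq> T" "S \<subseteq> {Suc j..card U - Suc j}" "inj_on (\<lambda>t. t mod p) S"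
        "min (Suc d - Suc j) (card U - 2 * Suc j) < card S"
      proof -
        have "Suc j \<le> Suc d" "2 * Suc j \<le> card U"
          using j cU(2) unfolding cU(1) by auto
        then show thesis using Suc.prems(3)[of "Suc j"] that by blast
      qed
      let ?S = "(\<lambda>t. t - 1) ` S"
      have "Suc (t - 1) = t" if "t \<in> S" for t
        using that S(2) by auto
      then have S_eq: "S = Suc ` ?S"
        by (simp add: image_image)
      have "inj_on (\<lambda>t. t mod p) (Suc ` ?S)"
        using S(3) S_eq by simp
      then have "inj_on (\<lambda>t. Suc t mod p) ?S"
        using comp_inj_on[of Suc ?S "\<lambda>t. t mod p"] by (simp add: comp_def)
      then have "inj_on (\<lambda>t. t mod p) ?S"
        unfolding inj_on_def by (metis mod_Suc_eq)
      moreover have "card ?S = card S"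
        by (metis S_eq card_image inj_Suc subset_UNIV inj_on_subset)
      moreover have "?S \<subseteq> {t. Suc t \<in> T}" using S(1) S_eq by blast
      moreover have "?S \<subseteq> {j..card (U - {i, k}) - j}" using S(2) cU by force
      ultimately show ?thesis using S(4) cU by (intro exI[of _ ?S]) auto
    qed
    fix X assume X: "X \<subseteq> U - {i, k}" "card X \<in> {t. Suc t \<in> T}"
    have "finite X" using X finU finite_subset by blast
    have nik: "i \<notin> X" "k \<notin> X" using X by auto
    \<comment> \<open>Both sets lie on one layer with size in \<open>T\<close>. In the difference
      the terms containing neither \<open>i\<close> nor \<open>k\<close> cancel, which leaves the
      value of \<open>h'\<close> at \<open>X\<close>.\<close>
    have "int p dvd (\<Sum>J | J \<subseteq> insert i X \<and> card J \<le> Suc d. b J) - (\<Sum>J | J \<subseteq> insert k X \<and> card J \<le> Suc d. b J)"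
      using X nik \<open>finite X\<close> ik by (intro dvd_diff Suc.prems(4)) auto
    then show "int p dvd (\<Sum>J | J \<subseteq> X \<and> card J \<le> d. b (insert i J) - b (insert k J))"
      using nik \<open>finite X\<close> by (simp add: sum_subsets_insert sum_subtractf)
  qed
  \<comment> \<open>The cap at \<open>card U\<close> guarantees a representative of every size up to
    \<open>D\<close>.\<close>
  define D where "D = min (Suc d) (card U)"
  define rep where "rep i = (SOME I. I \<subseteq> U \<and> card I = i)" for i
  have rep: "rep i \<subseteq> U \<and> card (rep i) = i" if "i \<le> D" for i
  proof -
    have "i \<le> card U" using that by (simp add: D_def)
    then have "\<exists>I. I \<subseteq> U \<and> card I = i" by (meson obtain_subset_with_card_n)
    then show ?thesis unfolding rep_def by (rule someI_ex)
  qed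
  have brep: "int p dvd b I - b (rep (card I))" if "I \<subseteq> U" "card I \<le> Suc d" for I
  proof -
    have "card I \<le> D" using that finU by (simp add: D_def card_mono)
    then have "rep (card I) \<subseteq> U" "card (rep (card I)) = card I" using rep by auto
    with that show ?thesis
      using exchange_invariant_cong[OF finU, of "Suc d" p b I "rep (card I)"] ex by simp
  qed
  obtain S where S: "S \<subseteq> T" "S \<subseteq> {0..card U}" "inj_on (\<lambda>t. t mod p) S" "D < card S"
    using Suc.prems(3)[of 0] by (auto simp: D_def)
  have cJ: "card J \<le> D" using Suc.prems finU by (simp add: D_def card_mono)
  have "int p dvd b (rep (card J))"
  proof (rule binomial_combination_dvd[OF assms(1) _ _ S(3,4) _ cJ, of "\<lambda>i. b (rep i)"])
    show "D < p" using Suc.prems(2) by (simp add: D_def)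
    show "finite S" using S(4) card.infinite by fastforce
    fix t assume t: "t \<in> S"
    then have "t \<in> T" "t \<le> card U" using S by auto
    then obtain X where X: "X \<subseteq> U" "card X = t" by (meson obtain_subset_with_card_n)
    then have finX: "finite X" using finU finite_subset by blast
    have le: "card I \<le> D \<longleftrightarrow> card I \<le> Suc d" if "I \<subseteq> X" for I
      using that X(1) finU by (auto simp: D_def intro: card_mono)
    \<comment> \<open>Modulo \<open>p\<close> a coefficient depends only on the size of its set, and
      \<open>X\<close> has \<open>t choose i\<close> subsets of size \<open>i\<close>; so the value
      at \<open>X\<close> is this combination of binomials.\<close>
    have "(\<Sum>i\<le>D. b (rep i) * int (t choose i)) = (\<Sum>i\<le>D. \<Sum>I | I \<subseteq> X \<and> card I = i. b (rep (card I)))"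
      using X finX by (intro sum.cong) (auto simp: n_subsets)
    also have "\<dots> = (\<Sum>I \<in> (\<Union>i\<le>D. {I. I \<subseteq> X \<and> card I = i}). b (rep (card I)))"
      using finX by (intro sum.UNION_disjoint[symmetric]) (auto intro: finite_subset[of _ "Pow X"])
    also have "(\<Union>i\<le>D. {I. I \<subseteq> X \<and> card I = i}) = {I. I \<subseteq> X \<and> card I \<le> Suc d}"
      using le by auto
    finally have 1: "(\<Sum>i\<le>D. b (rep i) * int (t choose i)) =
      (\<Sum>I | I \<subseteq> X \<and> card I \<le> Suc d. b I) - (\<Sum>I | I \<subseteq> X \<and> card I \<le> Suc d. b I - b (rep (card I)))"
      by (simp add: sum_subtractf)
    show "int p dvd (\<Sum>i\<le>D. b (rep i) * int (t choose i))"
      unfolding 1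
    proof (rule dvd_diff)
      show "int p dvd (\<Sum>I | I \<subseteq> X \<and> card I \<le> Suc d. b I)"
        using X \<open>t \<in> T\<close> by (intro Suc.prems(4)) auto
      show "int p dvd (\<Sum>I | I \<subseteq> X \<and> card I \<le> Suc d. b I - b (rep (card I)))"
        using X by (intro dvd_sum brep) auto
    qed
  qed
  moreover have "int p dvd b J - b (rep (card J))"
    using Suc.prems by (intro brep) auto
  ultimately show ?case by (metis diff_add_cancel dvd_add)
qed

section \<open>Residues of the available layers\<close>

lemma interval_mod_inj: "inj_on (\<lambda>t. t mod p) {a..<a + m}" if "m \<le> p" for a m p :: nat
proof (rule inj_onI)
  have *: "x = y" if "x \<in> {a..<a + m}" "y \<in> {a..<a + m}" "x mod p = y mod p" "x \<le> y" for x y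
  proof -
    have "p dvd y - x" using that mod_eq_dvd_iff_nat[of x y p] by simp
    moreover have "y - x < p" using that \<open>m \<le> p\<close> by auto
    ultimately show ?thesis using that(4) by (metis diff_is_0_eq' dvd_imp_le le_antisym not_gr_zero not_less diff_is_0_eq)
  qed
  fix x y assume "x \<in> {a..<a + m}" "y \<in> {a..<a + m}" "x mod p = y mod p"
  then show "x = y" using *[of x y] *[of y x] by (cases "x \<le> y") auto
qed

text \<open>Above \<open>Max K\<close> a run of layers is unobstructed. Below it,
  \<open>{j..N - j}\<close> is so long that enough layers survive the loss of two residues per
  element of \<open>K\<close>.\<close>

lemma enough_layers:
  fixes p :: nat
  assumes T_def: "T = {t. t mod p \<notin> K \<and> Suc t mod p \<notin> K}"
    and "K \<subseteq> {0..<p}" "K \<noteq> {}" "2 * card K + d = s" "s + card K \<le> p"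
    and "s + Max K \<le> Suc N" "j \<le> d" "2 * j \<le> N"
  shows "\<exists>S. S \<subseteq> T \<and> S \<subseteq> {j..N - j} \<and> inj_on (\<lambda>t. t mod p) S \<and> min (d - j) (N - 2 * j) < card S"
proof -
  let ?M = "Max K"
  have finK: "finite K" using assms(2) finite_subset by blast
  have r: "card K \<ge> 1" using finK assms(3) by (simp add: Suc_leI card_gt_0_iff)
  \<comment> \<open>The bound \<open>Suc t < p\<close> excludes \<open>p - 1\<close>, whose
    successor has residue 0, possibly in \<open>K\<close>.\<close>
  have notK: "t \<in> T" if "?M < t" "Suc t < p" for t
    using that finK by (auto simp: T_def dest: Max_ge)
  consider "j > ?M" | "j = ?M" | "j < ?M" by linarith
  then show ?thesis
  proof cases
    case 1
    let ?D = "min (d - j) (N - 2 * j)"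
    have "{j..<j + Suc ?D} \<subseteq> T"
      using 1 assms(4-) r by (intro subsetI notK) auto
    moreover have "inj_on (\<lambda>t. t mod p) {j..<j + Suc ?D}"
      using assms(4-) r by (intro interval_mod_inj) linarith
    moreover have "{j..<j + Suc ?D} \<subseteq> {j..N - j}"
      using assms(7,8) by auto
    ultimately show ?thesis
      by (intro exI[of _ "{j..<j + Suc ?D}"]) simp
  next
    case 2
    \<comment> \<open>The layer \<open>j\<close> itself is lost, being \<open>Max K\<close>, so the
      run starts one higher.\<close>
    have "{Suc j..<Suc j + Suc (d - j)} \<subseteq> T"
      using 2 assms(4-) r by (intro subsetI notK) auto
    moreover have "inj_on (\<lambda>t. t mod p) {Suc j..<Suc j + Suc (d - j)}"
      using assms(4-) r by (intro interval_mod_inj) linarith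
    moreover have "{Suc j..<Suc j + Suc (d - j)} \<subseteq> {j..N - j}"
      using 2 assms(4-) r by auto
    ultimately show ?thesis
      by (intro exI[of _ "{Suc j..<Suc j + Suc (d - j)}"]) simp
  next
    case 3
    \<comment> \<open>Since \<open>N \<ge> s + ?M - 1\<close>, an interval of length
      \<open>s + ?M - 2 * j\<close> from \<open>j\<close> stays within \<open>N - j\<close>; the cap
      \<open>p\<close> keeps its residues distinct.\<close>
    define m where "m = min p (s + ?M - 2 * j)"
    let ?I = "{j..<j + m}"
    have inj: "inj_on (\<lambda>t. t mod p) ?I" by (rule interval_mod_inj) (simp add: m_def)
    have "inj_on (\<lambda>t. t mod p) (Suc ` ?I)"
      using interval_mod_inj[of m p "Suc j"] by (simp add: m_def)
    then have inj': "inj_on (\<lambda>t. Suc t mod p) ?I"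
      using comp_inj_on[of Suc ?I "\<lambda>t. t mod p"] by (simp add: comp_def)
    have "card {t \<in> ?I. t mod p \<in> K} \<le> card K"
      using finK inj by (intro card_inj_on_le[where f = "\<lambda>t. t mod p"]) (auto simp: inj_on_def)
    moreover have "card {t \<in> ?I. Suc t mod p \<in> K} \<le> card K"
      using finK inj' by (intro card_inj_on_le[where f = "\<lambda>t. Suc t mod p"]) (auto simp: inj_on_def)
    moreover have "?I - T = {t \<in> ?I. t mod p \<in> K} \<union> {t \<in> ?I. Suc t mod p \<in> K}"
      by (auto simp: T_def)
    ultimately have "card (?I - T) \<le> 2 * card K"
      by (metis (no_types, lifting) add_mono card_Un_le mult_2 order_trans)
    moreover have "card (?I \<inter> T) + card (?I - T) = m"
      using card_Un_disjoint[of "?I \<inter> T" "?I - T"] by (simp add: Int_Diff_Un Int_Diff_disjoint)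
    ultimately have "m \<le> card (?I \<inter> T) + 2 * card K" by linarith
    moreover have "d - j + 2 * card K < m"
      using 3 assms(4-) r by (simp add: m_def) linarith
    moreover have "?I \<subseteq> {j..N - j}"
      using assms(4-) 3 by (auto simp: m_def)
    ultimately show ?thesis
      using inj by (intro exI[of _ "?I \<inter> T"]) (auto intro: inj_on_subset)
  qed
qed

section \<open>Counting monomials\<close>

text \<open>The \<open>m\<close> largest sizes are peeled off one by one. Writing
  \<open>card J + m \<le> s\<close> without subtraction leaves an empty remainder once
  \<open>m > s\<close>.\<close>

lemma card_subsets_binom_int:
  assumes "finite U"
  shows "card {J. J \<subseteq> U \<and> card J \<le> s} =
    (\<Sum>j<m. binom_int (card U) (int s - int j)) + card {J. J \<subseteq> U \<and> card J + m \<le> s}"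
proof (induction m)
  case (Suc m)
  have fin: "finite {J. J \<subseteq> U \<and> P J}" for P
    using assms by (auto intro: finite_subset[of _ "Pow U"])
  have "{J. J \<subseteq> U \<and> card J + m \<le> s} = {J. J \<subseteq> U \<and> card J + m = s} \<union> {J. J \<subseteq> U \<and> card J + Suc m \<le> s}"
    by auto
  then have "card {J. J \<subseteq> U \<and> card J + m \<le> s} = card {J. J \<subseteq> U \<and> card J + m = s} + card {J. J \<subseteq> U \<and> card J + Suc m \<le> s}"
    by (simp only:) (rule card_Un_disjoint; auto simp: fin)
  moreover have "card {J. J \<subseteq> U \<and> card J + m = s} = binom_int (card U) (int s - int m)"
  proof (cases "m \<le> s")
    case True
    then have "{J. J \<subseteq> U \<and> card J + m = s} = {J. J \<subseteq> U \<and> card J = s - m}" by auto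
    then show ?thesis using True assms by (simp add: binom_int_def n_subsets flip: of_nat_diff)
  next
    case False
    then have "{J. J \<subseteq> U \<and> card J + m = s} = {}" by auto
    then show ?thesis using False by (simp only: binom_int_def) simp
  qed
  ultimately show ?case using Suc by simp
qed simp

lemma prime_dvd_prod_diff_iff:
  fixes p m :: nat
  assumes "prime p" "M \<subseteq> {0..<p}"
  shows "int p dvd (\<Prod>l\<in>M. int m - int l) \<longleftrightarrow> m mod p \<in> M"
proof -
  have "finite M" using assms(2) finite_subset by blast
  then have "int p dvd (\<Prod>l\<in>M. int m - int l) \<longleftrightarrow> (\<exists>l\<in>M. int p dvd int m - int l)"
    using assms(1) by (simp add: prime_dvd_prod_iff)
  also have "\<dots> \<longleftrightarrow> (\<exists>l\<in>M. m mod p = l mod p)"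
    by (simp add: mod_eq_dvd_iff[symmetric] flip: zmod_int)
  also have "\<dots> \<longleftrightarrow> m mod p \<in> M"
    using assms(2) by (metis atLeastLessThan_iff mod_less subsetD)
  finally show ?thesis .
qed

section \<open>The linear independence argument\<close>

theorem theorem2p10:
  fixes p n :: nat and K L :: "nat set" and \<A> :: "nat set set"
  assumes "prime p"
    and "K \<subseteq> {0..<p}" and "L \<subseteq> {0..<p}" and "K \<inter> L = {}"
    and "K \<noteq> {}"
    and "\<A> \<subseteq> Pow {1..n}"
    and "\<And>A. A \<in> \<A> \<Longrightarrow> card A mod p \<in> K"
    and "\<And>A B. A \<in> \<A> \<Longrightarrow> B \<in> \<A> \<Longrightarrow> A \<noteq> B \<Longrightarrow> card (A \<inter> B) mod p \<in> L"
    and "n \<ge> card L + Max K"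
  shows "card \<A> \<le> (\<Sum>j<2 * card K. binom_int (n - 1) (int (card L) - int j))"
proof (cases "n = 0")
  case True
  have "finite K" using assms(2) finite_subset by blast
  then have "card K > 0" using assms(5) by (simp add: card_gt_0_iff)
  have "card \<A> \<le> card {{} :: nat set}"
    using assms(6) True by (intro card_mono) auto
  \<comment> \<open>For \<open>n = 0\<close> the size hypothesis forces \<open>card L = 0\<close>,
    and truncated \<open>n - 1\<close> is 0, so the leading term is 1.\<close>
  also have "\<dots> = binom_int (n - 1) (int (card L) - int 0)"
    using True assms(9) by (simp add: binom_int_def)
  also have "\<dots> \<le> (\<Sum>j<2 * card K. binom_int (n - 1) (int (card L) - int j))"
    using \<open>card K > 0\<close> by (intro member_le_sum) auto
  finally show ?thesis .
next
  case False
  define U where "U = {1..n - 1}"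
  have U: "finite U" "card U = n - 1" "n \<notin> U" "insert n U = {1..n}"
    using False by (auto simp: U_def)
  have finK: "finite K" and finL: "finite L" using assms(2,3) finite_subset by blast+
  have finA: "finite \<A>" using assms(6) finite_subset by blast
  have finU: "X \<subseteq> U \<Longrightarrow> finite X" for X using U finite_subset by blast
  have nX: "X \<subseteq> U \<Longrightarrow> n \<notin> X" for X using U by blast
  define \<H> where "\<H> = {H. H \<subseteq> U \<and> card H + 2 * card K \<le> card L}"
  have finH: "finite \<H>" unfolding \<H>_def using U by (auto intro: finite_subset[of _ "Pow U"])
  define f where "f A X = (\<Prod>l\<in>L. int (card (A \<inter> insert n X)) - int l)" for A X
  \<comment> \<open>At \<open>A - {n}\<close>, of size \<open>card A\<close> or
    \<open>card A - 1\<close>, one of the two products vanishes modulo \<open>p\<close>.\<close>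
  define g where "g X = (\<Prod>k\<in>K. int (card X) - int k) * (\<Prod>k\<in>K. int (Suc (card X)) - int k)" for X :: "nat set"
  define T where "T = {t. t mod p \<notin> K \<and> Suc t mod p \<notin> K}"
  have f_dvd: "int p dvd f A X \<longleftrightarrow> card (A \<inter> insert n X) mod p \<in> L" for A X
    unfolding f_def by (rule prime_dvd_prod_diff_iff[OF assms(1,3)])
  have g_dvd: "int p dvd g X \<longleftrightarrow> card X \<notin> T" for X
    using assms(1) prime_dvd_prod_diff_iff[OF assms(1,2)]
    by (auto simp: g_def T_def prime_dvd_mult_iff simp del: of_nat_Suc)
  have f_deg: "multilinear_le U (card L) (f A)" for A
  proof -
    have "multilinear_le U 0 (\<lambda>X. of_bool ({} \<subseteq> X))"
      using U by (intro multilinear_le_monomial) auto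
    then have "multilinear_le U (0 + card L) (\<lambda>X. of_bool ({} \<subseteq> X) *
        (\<Prod>l\<in>L. (of_bool (n \<in> A) - int l) + int (card ((A - {n}) \<inter> X))))"
      using U finL by (intro multilinear_le_mult_prod_linear) auto
    then have "multilinear_le U (card L)
        (\<lambda>X. \<Prod>l\<in>L. (of_bool (n \<in> A) - int l) + int (card ((A - {n}) \<inter> X)))" by simp
    then show ?thesis
    proof (rule multilinear_le_cong)
      fix X assume X: "X \<subseteq> U"
      have "int (card (A \<inter> insert n X)) = of_bool (n \<in> A) + int (card ((A - {n}) \<inter> X))"
      proof (cases "n \<in> A")
        case True
        have "(A - {n}) \<inter> X = A \<inter> X" using nX[OF X] by auto
        then show ?thesis using True nX[OF X] finU[OF X] by simp
      next
        case False
        then have "(A - {n}) \<inter> X = A \<inter> insert n X" by auto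
        then show ?thesis using False by simp
      qed
      then show "(\<Prod>l\<in>L. (of_bool (n \<in> A) - int l) + int (card ((A - {n}) \<inter> X))) = f A X"
        by (simp add: f_def algebra_simps)
    qed
  qed
  have g_deg: "multilinear_le U (card L) (\<lambda>X. of_bool (H \<subseteq> X) * g X)" if "H \<in> \<H>" for H
  proof -
    have H: "card H + card K + card K \<le> card L" using that by (simp add: \<H>_def)
    have "multilinear_le U (card H + card K + card K) (\<lambda>X. of_bool (H \<subseteq> X) *
        (\<Prod>k\<in>K. - int k + int (card (U \<inter> X))) * (\<Prod>k\<in>K. (1 - int k) + int (card (U \<inter> X))))"
      using U finK by (intro multilinear_le_mult_prod_linear multilinear_le_monomial) auto
    from multilinear_le_mono[OF this H U(1)] show ?thesis
      by (rule multilinear_le_cong) (simp add: g_def Int_absorb1 algebra_simps)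
  qed
  show ?thesis
  proof (rule ccontr)
    assume "\<not> ?thesis"
    then have "card {J. J \<subseteq> U \<and> card J \<le> card L} < card \<A> + card \<H>"
      \<comment> \<open>With \<open>m = 2 * card K\<close> the remainder is
        \<open>card \<H>\<close>, so violating the bound yields more functions than
        monomials.\<close>
      using card_subsets_binom_int[OF U(1), of "card L" "2 * card K"] U(2) by (simp add: \<H>_def)
    then have lt: "card {J. J \<subseteq> U \<and> card J \<le> card L} < card (\<A> <+> \<H>)"
      using finA finH by (simp add: card_Plus)
    define F where "F v = (case v of Inl A \<Rightarrow> f A | Inr H \<Rightarrow> (\<lambda>X. of_bool (H \<subseteq> X) * g X))" for v
    have "multilinear_le U (card L) (F v)" if "v \<in> \<A> <+> \<H>" for v
      using that f_deg g_deg by (auto simp: F_def)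
    then obtain c where c: "\<exists>v\<in>\<A> <+> \<H>. \<not> int p dvd c v"
      "\<And>X. X \<subseteq> U \<Longrightarrow> int p dvd (\<Sum>v\<in>\<A> <+> \<H>. c v * F v X)"
      using multilinear_le_dependent_mod[OF U(1) finite_Plus[OF finA finH] prime_gt_1_nat[OF assms(1)] _ lt]
      by blast
    have rel: "int p dvd (\<Sum>A\<in>\<A>. c (Inl A) * f A X) + g X * (\<Sum>H\<in>\<H>. c (Inr H) * of_bool (H \<subseteq> X))"
      if "X \<subseteq> U" for X
      using c(2)[OF that] finA finH by (simp add: sum.Plus F_def sum_distrib_left mult_ac
        del: sum_mult_of_bool_eq sum_of_bool_mult_eq)
    \<comment> \<open>If \<open>n \<in> A\<close>, putting \<open>n\<close> back gives
      \<open>A\<close>, so \<open>f B\<close> sees \<open>B \<inter> A\<close> for every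
      \<open>B\<close>. If \<open>n \<notin> A\<close>, only the \<open>B\<close> avoiding
      \<open>n\<close> do so; the coefficients of the others must already be known to
      vanish.\<close>
    have eval: "int p dvd c (Inl A)"
      if A: "A \<in> \<A>" and T: "card (A - {n}) \<notin> T"
        and own: "A \<inter> insert n (A - {n}) = A"
        and others: "\<And>B. B \<in> \<A> \<Longrightarrow> B \<noteq> A \<Longrightarrow> int p dvd c (Inl B) \<or> B \<inter> insert n (A - {n}) = B \<inter> A" for A
    proof -
      have "A - {n} \<subseteq> U" using A assms(6) U(4) by auto
      moreover have "int p dvd g (A - {n}) * (\<Sum>H\<in>\<H>. c (Inr H) * of_bool (H \<subseteq> A - {n}))"
        using T g_dvd by (intro dvd_mult2) blast
      ultimately have "int p dvd (\<Sum>B\<in>\<A>. c (Inl B) * f B (A - {n}))"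
        using rel dvd_add_left_iff by blast
      moreover have "int p dvd (\<Sum>B\<in>\<A> - {A}. c (Inl B) * f B (A - {n}))"
      proof (rule dvd_sum)
        fix B assume B: "B \<in> \<A> - {A}"
        have "int p dvd c (Inl B) \<or> int p dvd f B (A - {n})"
        proof (cases "int p dvd c (Inl B)")
          case False
          then have "B \<inter> insert n (A - {n}) = B \<inter> A" using others[of B] B by blast
          then show ?thesis unfolding f_dvd using assms(8)[of B A] A B by simp
        qed simp
        then show "int p dvd c (Inl B) * f B (A - {n})" by auto
      qed
      ultimately have "int p dvd c (Inl A) * f A (A - {n})"
        unfolding sum.remove[OF finA A] using dvd_add_left_iff by blast
      moreover have "\<not> int p dvd f A (A - {n})"
        unfolding f_dvd own using assms(4) assms(7)[OF A] by auto
      ultimately show ?thesis using assms(1) by (simp add: prime_dvd_mult_iff)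
    qed
    have finAA: "A \<in> \<A> \<Longrightarrow> finite A" for A using assms(6) finite_subset by blast
    have in_n: "int p dvd c (Inl A)" if "A \<in> \<A>" "n \<in> A" for A
    proof (rule eval)
      have "Suc (card (A - {n})) = card A" using that finAA by (intro card_Suc_Diff1) auto
      then show "card (A - {n}) \<notin> T" using assms(7)[OF that(1)] by (simp add: T_def)
    qed (use that in \<open>auto simp: insert_absorb\<close>)
    have c_A: "int p dvd c (Inl A)" if "A \<in> \<A>" for A
    proof (cases "n \<in> A")
      case False
      show ?thesis
      proof (rule eval)
        show "card (A - {n}) \<notin> T" using assms(7)[OF that] False by (simp add: T_def)
      qed (use that False in_n in auto)
    qed (use that in_n in auto)
    have c_H: "int p dvd c (Inr H)" if H: "H \<in> \<H>" for H
    proof (rule coeffs_dvd_if_vanishing_on_layers[OF assms(1) U(1),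
          where T = T and d = "card L - 2 * card K" and b = "\<lambda>H. c (Inr H)"])
      have s: "2 * card K \<le> card L" using H by (simp add: \<H>_def)
      \<comment> \<open>Disjointness of \<open>K\<close> and \<open>L\<close> among the
        \<open>p\<close> residues keeps the degree below \<open>p\<close>.\<close>
      have "card (K \<union> L) \<le> card {0..<p}" using assms(2,3) by (intro card_mono) auto
      then have rs: "card L + card K \<le> p"
        using assms(4) finK finL by (simp add: card_Un_disjoint)
      have "card K > 0" using finK assms(5) by (simp add: card_gt_0_iff)
      then show "card L - 2 * card K < p" using rs s by linarith
      show "H \<subseteq> U" "card H \<le> card L - 2 * card K" using H by (auto simp: \<H>_def)
      show "\<exists>S\<subseteq>T. S \<subseteq> {j..card U - j} \<and> inj_on (\<lambda>t. t mod p) S \<and>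
          min (card L - 2 * card K - j) (card U - 2 * j) < card S"
        if "j \<le> card L - 2 * card K" "2 * j \<le> card U" for j
        using s rs that U(2) assms(9) False
        by (intro enough_layers[OF T_def assms(2,5), of _ "card L"]) auto
      fix X assume X: "X \<subseteq> U" "card X \<in> T"
      have "int p dvd (\<Sum>A\<in>\<A>. c (Inl A) * f A X)"
        using c_A by (intro dvd_sum) auto
      with rel[OF X(1)] have "int p dvd g X * (\<Sum>H\<in>\<H>. c (Inr H) * of_bool (H \<subseteq> X))"
        using dvd_add_right_iff by blast
      then have "int p dvd (\<Sum>H\<in>\<H>. c (Inr H) * of_bool (H \<subseteq> X))"
        using g_dvd[of X] X(2) assms(1) by (auto simp only: prime_dvd_mult_iff prime_nat_int_transfer)
      also have "(\<Sum>H\<in>\<H>. c (Inr H) * of_bool (H \<subseteq> X)) =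
          (\<Sum>J | J \<subseteq> X \<and> card J \<le> card L - 2 * card K. c (Inr J))"
        using X(1) finH s by (intro sum.mono_neutral_cong_right) (auto simp: \<H>_def)
      finally show "int p dvd (\<Sum>J | J \<subseteq> X \<and> card J \<le> card L - 2 * card K. c (Inr J))" .
    qed
    show False using c(1) c_A c_H by auto
  qed
qed

end
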